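(* Let $q \ge 1$ be an integer and let $\Gamma = \langle Z, D\rangle$ be a $q$-uniform hypergraph with finite vertex set $Z$ and finite edge set $D$. For $B \subseteq Z$, let $K_B$ be the bipartite graph with vertex classes $D$ and $Z \setminus B$ in which $a \in D$ is adjacent to $z \in Z\setminus B$ iff $z \in \Gamma a$. Then the following are equivalent: (i) for every set $B \subseteq Z$ with $|B| = q-1$, the bipartite graph $K_B$ has a matching saturating every vertex of $D$; (ii) $\Gamma$ is a hyperforest, i.e. $|\Gamma A| - q + 1 \ge |A|$ for every nonempty $A \subseteq D$. *)

theory Defs
  imports Main
begin

text \<open>A hypergraph is given by a vertex set \<open>Z\<close>, a set \<open>D\<close> of edge names and an incidence map
  \<open>\<Gamma>\<close> sending each edge to its set of vertices; distinct edges may have the same vertices.\<close>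

definition finite_hypergraph :: "'v set \<Rightarrow> 'e set \<Rightarrow> ('e \<Rightarrow> 'v set) \<Rightarrow> bool" where
  "finite_hypergraph Z D \<Gamma> \<longleftrightarrow> finite Z \<and> finite D \<and> (\<forall>a\<in>D. \<Gamma> a \<subseteq> Z)"

definition uniform_hypergraph :: "nat \<Rightarrow> 'v set \<Rightarrow> 'e set \<Rightarrow> ('e \<Rightarrow> 'v set) \<Rightarrow> bool" where
  "uniform_hypergraph q Z D \<Gamma> \<longleftrightarrow> finite_hypergraph Z D \<Gamma> \<and> (\<forall>a\<in>D. card (\<Gamma> a) = q)"

definition covered :: "('e \<Rightarrow> 'v set) \<Rightarrow> 'e set \<Rightarrow> 'v set" where
  "covered \<Gamma> A = (\<Union>a\<in>A. \<Gamma> a)"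

definition hyperforest :: "nat \<Rightarrow> 'e set \<Rightarrow> ('e \<Rightarrow> 'v set) \<Rightarrow> bool" where
  "hyperforest q D \<Gamma> \<longleftrightarrow>
     (\<forall>A. A \<subseteq> D \<and> A \<noteq> {} \<longrightarrow> int (card (covered \<Gamma> A)) - int q + 1 \<ge> int (card A))"

text \<open>A graph is a pair of a vertex set and a set of two-element vertex sets.\<close>

type_synonym 'a graph = "'a set \<times> 'a set set"

definition verts :: "'a graph \<Rightarrow> 'a set" where
  "verts G = fst G"

definition edges :: "'a graph \<Rightarrow> 'a set set" where
  "edges G = snd G"

definition matching :: "'a graph \<Rightarrow> 'a set set \<Rightarrow> bool" where
  "matching G M \<longleftrightarrow> M \<subseteq> edges G \<and> pairwise disjnt M"

definition saturates :: "'a set set \<Rightarrow> 'a set \<Rightarrow> bool" where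
  "saturates M S \<longleftrightarrow> (\<forall>v\<in>S. \<exists>e\<in>M. v \<in> e)"

text \<open>The sum type keeps the two vertex classes disjoint.\<close>

definition K_graph :: "'v set \<Rightarrow> 'e set \<Rightarrow> ('e \<Rightarrow> 'v set) \<Rightarrow> 'v set \<Rightarrow> ('e + 'v) graph" where
  "K_graph Z D \<Gamma> B =
     (Inl ` D \<union> Inr ` (Z - B), {{Inl a, Inr z} | a z. a \<in> D \<and> z \<in> Z - B \<and> z \<in> \<Gamma> a})"

end

theory Submission
  imports Defs
begin

text \<open>A matching of \<open>K\<^sub>B\<close> saturating \<open>D\<close> is a system of distinct representatives of the sets
  \<open>\<Gamma> a - B\<close>. By Hall's theorem it exists as soon as \<open>|\<Gamma>A - B| \<ge> |A|\<close> for all \<open>A\<close>, and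
  \<open>|\<Gamma>A - B| \<ge> |\<Gamma>A| - (q - 1)\<close>. Conversely, for nonempty \<open>A\<close> uniformity allows choosing
  \<open>B\<close> inside \<open>\<Gamma>A\<close>, and the representatives of \<open>A\<close> then lie in a set of exactly
  \<open>|\<Gamma>A| - (q - 1)\<close> elements.\<close>

text \<open>The proof by Halmos and Vaughan: either some nonempty proper subfamily is tight and the
  problem splits along it, or any choice of a single representative leaves enough room.\<close>

lemma hall_marriage:
  assumes "finite I" and "\<And>i. i \<in> I \<Longrightarrow> finite (S i)"
    and "\<And>J. J \<subseteq> I \<Longrightarrow> card J \<le> card (\<Union>i\<in>J. S i)"
  shows "\<exists>f. inj_on f I \<and> (\<forall>i\<in>I. f i \<in> S i)"
  using assms
proof (induction I arbitrary: S rule: finite_psubset_induct)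
  case (psubset I S)
  note fin = \<open>finite I\<close>
  note finS = psubset.prems(1)
  note hall = psubset.prems(2)
  show ?case
  proof (cases "\<exists>J. J \<subset> I \<and> J \<noteq> {} \<and> card J = card (\<Union>i\<in>J. S i)")
    case True
    then obtain J where J: "J \<subset> I" "J \<noteq> {}" and tight: "card J = card (\<Union>i\<in>J. S i)"
      by blast
    let ?U = "\<Union>i\<in>J. S i"
    have "\<exists>f. inj_on f J \<and> (\<forall>i\<in>J. f i \<in> S i)"
      using J by (intro psubset.IH finS hall) auto
    then obtain f where f: "inj_on f J" "\<forall>i\<in>J. f i \<in> S i" by blast
    \<comment> \<open>The rest of the family is represented outside \<open>?U\<close>, so that no
      clash with \<open>f\<close> can occur. For \<open>K\<close> outside \<open>J\<close>, Hall's
      condition for \<open>K \<union> J\<close> bounds \<open>card K + card J\<close>, and tightness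
      of \<open>J\<close> cancels exactly the part lost by removing \<open>?U\<close>.\<close>
    have "\<exists>g. inj_on g (I - J) \<and> (\<forall>i\<in>I - J. g i \<in> S i - ?U)"
    proof (rule psubset.IH)
      show "I - J \<subset> I" using J by blast
      show "finite (S i - ?U)" if "i \<in> I - J" for i using that finS by blast
      fix K assume K: "K \<subseteq> I - J"
      have "card K + card J = card (K \<union> J)"
        using K J fin by (subst card_Un_disjoint) (auto intro: finite_subset)
      also have "\<dots> \<le> card (\<Union>i\<in>K \<union> J. S i)" using K J by (intro hall) auto
      also have "(\<Union>i\<in>K \<union> J. S i) = (\<Union>i\<in>K. S i - ?U) \<union> ?U" by blast
      also have "card \<dots> \<le> card (\<Union>i\<in>K. S i - ?U) + card ?U" by (rule card_Un_le)
      finally show "card K \<le> card (\<Union>i\<in>K. S i - ?U)" using tight by simp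
    qed
    then obtain g where g: "inj_on g (I - J)" "\<forall>i\<in>I - J. g i \<in> S i - ?U" by blast
    let ?h = "\<lambda>i. if i \<in> J then f i else g i"
    have "inj_on ?h I"
    proof (rule inj_onI)
      fix i j assume ij: "i \<in> I" "j \<in> I" "?h i = ?h j"
      have cross: "f a \<noteq> g b" if "a \<in> J" "b \<in> I - J" for a b using that f(2) g(2) by force
      show "i = j"
        using ij f(1) g(1) cross[of i j] cross[of j i]
        by (auto simp: inj_on_def split: if_splits)
    qed
    moreover have "\<forall>i\<in>I. ?h i \<in> S i" using f(2) g(2) by auto
    ultimately show ?thesis by blast
  next
    case False
    show ?thesis
    proof (cases "I = {}")
      case False
      then obtain i where i: "i \<in> I" by blast
      have "S i \<noteq> {}" using hall[of "{i}"] i by auto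
      then obtain x where x: "x \<in> S i" by blast
      have "\<exists>g. inj_on g (I - {i}) \<and> (\<forall>j\<in>I - {i}. g j \<in> S j - {x})"
      proof (rule psubset.IH)
        show "I - {i} \<subset> I" using i by blast
        show "finite (S j - {x})" if "j \<in> I - {i}" for j using that finS by blast
        fix K assume K: "K \<subseteq> I - {i}"
        show "card K \<le> card (\<Union>j\<in>K. S j - {x})"
        proof (cases "K = {}")
          case False
          \<comment> \<open>\<open>K\<close> omits \<open>i\<close>, so it is a nonempty proper
            subfamily and not tight. The surplus of at least one element pays for the removal of
            \<open>x\<close>.\<close>
          with K i \<open>\<nexists>J. J \<subset> I \<and> J \<noteq> {} \<and> card J = card (\<Union>i\<in>J. S i)\<close>
          have "card K \<noteq> card (\<Union>j\<in>K. S j)" by blast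
          moreover have "card K \<le> card (\<Union>j\<in>K. S j)" using K by (intro hall) auto
          moreover have "card (\<Union>j\<in>K. S j) - 1 \<le> card ((\<Union>j\<in>K. S j) - {x})"
            using diff_card_le_card_Diff[of "{x}" "\<Union>j\<in>K. S j"] by simp
          moreover have "(\<Union>j\<in>K. S j - {x}) = (\<Union>j\<in>K. S j) - {x}" by blast
          ultimately show ?thesis by simp
        qed simp
      qed
      then obtain g where g: "inj_on g (I - {i})" "\<forall>j\<in>I - {i}. g j \<in> S j - {x}" by blast
      have "inj_on (g(i := x)) I"
        using g by (fastforce simp: inj_on_def)
      moreover have "\<forall>j\<in>I. (g(i := x)) j \<in> S j" using g(2) x by auto
      ultimately show ?thesis by blast
    qed simp
  qed
qed

text \<open>An edge at \<open>Inl a\<close> names a representative of \<open>a\<close> through its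
  other end, and disjointness of the edges amounts to injectivity of the choice. The inclusion in
  \<open>Z\<close> ensures that chosen representatives are vertices of the graph.\<close>

lemma K_graph_saturating_matching_iff:
  assumes "\<And>a. a \<in> D \<Longrightarrow> \<Gamma> a \<subseteq> Z"
  shows "(\<exists>M. matching (K_graph Z D \<Gamma> B) M \<and> saturates M (Inl ` D)) \<longleftrightarrow>
    (\<exists>f. inj_on f D \<and> (\<forall>a\<in>D. f a \<in> \<Gamma> a - B))" (is "?L \<longleftrightarrow> ?R")
proof
  assume ?L
  then obtain M where sub: "M \<subseteq> edges (K_graph Z D \<Gamma> B)" and disj: "pairwise disjnt M"
    and sat: "saturates M (Inl ` D)"
    unfolding matching_def by blast
  have "\<exists>z. z \<in> \<Gamma> a - B \<and> {Inl a, Inr z} \<in> M" if a: "a \<in> D" for a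
  proof -
    obtain e where e: "e \<in> M" "Inl a \<in> e" using sat a unfolding saturates_def by blast
    with sub obtain b z where "e = {Inl b, Inr z}" "z \<in> \<Gamma> b - B"
      unfolding edges_def K_graph_def by auto
    with e show ?thesis by auto
  qed
  then obtain f where f: "\<And>a. a \<in> D \<Longrightarrow> f a \<in> \<Gamma> a - B \<and> {Inl a, Inr (f a)} \<in> M"
    by metis
  have "inj_on f D"
  proof (rule inj_onI)
    fix a b assume ab: "a \<in> D" "b \<in> D" "f a = f b"
    \<comment> \<open>The two matching edges share the end \<open>Inr (f a)\<close>, so they
      coincide, and then so do their ends in \<open>D\<close>.\<close>
    then have "\<not> disjnt {Inl a, Inr (f a)} {Inl b, Inr (f b)}" by (simp add: disjnt_def)
    then have "{Inl a, Inr (f a)} = {Inl b, Inr (f b)}"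
      using pairwiseD[OF disj] f ab(1,2) by blast
    then show "a = b" by (auto simp: doubleton_eq_iff)
  qed
  with f show ?R by blast
next
  assume ?R
  then obtain f where f: "inj_on f D" "\<forall>a\<in>D. f a \<in> \<Gamma> a - B" by blast
  let ?M = "(\<lambda>a. {Inl a, Inr (f a)}) ` D"
  have "?M \<subseteq> edges (K_graph Z D \<Gamma> B)"
    using f(2) assms unfolding edges_def K_graph_def by fastforce
  moreover have "pairwise disjnt ?M"
    using f(1) by (auto simp: pairwise_def disjnt_def inj_on_def)
  moreover have "saturates ?M (Inl ` D)" unfolding saturates_def by auto
  ultimately show ?L unfolding matching_def by blast
qed

theorem theorem1:
  fixes q :: nat and Z :: "'v set" and D :: "'e set" and \<Gamma> :: "'e \<Rightarrow> 'v set"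
  assumes "q \<ge> 1" and "uniform_hypergraph q Z D \<Gamma>"
  shows "(\<forall>B. B \<subseteq> Z \<and> card B = q - 1 \<longrightarrow>
            (\<exists>M. matching (K_graph Z D \<Gamma> B) M \<and> saturates M (Inl ` D)))
         \<longleftrightarrow> hyperforest q D \<Gamma>"
proof -
  have finZ: "finite Z" and finD: "finite D" and sub: "\<And>a. a \<in> D \<Longrightarrow> \<Gamma> a \<subseteq> Z"
    and unif: "\<And>a. a \<in> D \<Longrightarrow> card (\<Gamma> a) = q"
    using assms(2) unfolding uniform_hypergraph_def finite_hypergraph_def by auto
  have covZ: "covered \<Gamma> A \<subseteq> Z" if "A \<subseteq> D" for A
    using that sub unfolding covered_def by blast
  have finc: "finite (covered \<Gamma> A)" if "A \<subseteq> D" for A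
    using covZ[OF that] finZ by (rule finite_subset)
  have "(\<forall>B. B \<subseteq> Z \<and> card B = q - 1 \<longrightarrow> (\<exists>f. inj_on f D \<and> (\<forall>a\<in>D. f a \<in> \<Gamma> a - B)))
    \<longleftrightarrow> hyperforest q D \<Gamma>" (is "?L \<longleftrightarrow> _")
  proof
    assume L: ?L
    show "hyperforest q D \<Gamma>"
      unfolding hyperforest_def
    proof (intro allI impI)
      fix A assume A: "A \<subseteq> D \<and> A \<noteq> {}"
      then obtain a where a: "a \<in> A" by blast
      \<comment> \<open>A single edge of \<open>A\<close> already covers \<open>q\<close> vertices.
        This leaves room for \<open>B\<close> inside \<open>covered \<Gamma> A\<close> and keeps the
        later subtraction of \<open>q - 1\<close> from truncating.\<close>
      have "q \<le> card (covered \<Gamma> A)"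
        using unif[of a] a A finc[of A] card_mono[of "covered \<Gamma> A" "\<Gamma> a"]
        by (auto simp: covered_def)
      then obtain B where B: "B \<subseteq> covered \<Gamma> A" "card B = q - 1"
        by (meson diff_le_self le_trans obtain_subset_with_card_n)
      then obtain f where f: "inj_on f D" "\<forall>a\<in>D. f a \<in> \<Gamma> a - B"
        using L covZ A by (meson subset_trans)
      have "card A = card (f ` A)" using f(1) A by (metis card_image inj_on_subset)
      also have "\<dots> \<le> card (covered \<Gamma> A - B)"
        using f(2) A finc[of A] by (intro card_mono) (auto simp: covered_def)
      also have "\<dots> = card (covered \<Gamma> A) - (q - 1)"
        using B finc[of A] A by (metis card_Diff_subset finite_subset)
      finally show "int (card A) \<le> int (card (covered \<Gamma> A)) - int q + 1"
        using \<open>q \<le> card (covered \<Gamma> A)\<close> \<open>q \<ge> 1\<close> by linarith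
    qed
  next
    assume H: "hyperforest q D \<Gamma>"
    show ?L
    proof (intro allI impI)
      fix B assume B: "B \<subseteq> Z \<and> card B = q - 1"
      show "\<exists>f. inj_on f D \<and> (\<forall>a\<in>D. f a \<in> \<Gamma> a - B)"
      proof (rule hall_marriage[OF finD])
        show "finite (\<Gamma> a - B)" if "a \<in> D" for a
          using sub[OF that] finZ by (auto intro: finite_subset)
        fix A assume A: "A \<subseteq> D"
        show "card A \<le> card (\<Union>a\<in>A. \<Gamma> a - B)"
        \<comment> \<open>The hyperforest inequality speaks only of nonempty sets, whereas Hall's
          condition includes the empty one.\<close>
        proof (cases "A = {}")
          case False
          with H A have "int (card A) \<le> int (card (covered \<Gamma> A)) - int q + 1"
            unfolding hyperforest_def by blast
          \<comment> \<open>Here \<open>B\<close> may stick out of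
            \<open>covered \<Gamma> A\<close>, so removing it costs at most \<open>q - 1\<close>
            vertices; the lower bound is enough.\<close>
          moreover have "card (covered \<Gamma> A) - card B \<le> card (covered \<Gamma> A - B)"
            using B finZ by (intro diff_card_le_card_Diff) (auto intro: finite_subset)
          moreover have "(\<Union>a\<in>A. \<Gamma> a - B) = covered \<Gamma> A - B"
            unfolding covered_def by blast
          ultimately show ?thesis using B \<open>q \<ge> 1\<close> by auto
        qed simp
      qed
    qed
  qed
  then show ?thesis by (simp only: K_graph_saturating_matching_iff[OF sub])
qed

end
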